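(* Let $(\mathcal{B},\mu)$ be a strictly positive atomless normalized measure algebra. For all $x,y,z\in[0,1]$, $$(x\star y)\star z=x\star(y\star z)=\left[(x+y+z-2)^+,\ \min\{x,y,z\}\right].$$
   Context: A strictly positive atomless normalized measure algebra $(\mathcal{B},\mu)$ is a Dedekind $\sigma$-complete Boolean algebra $\mathcal{B}$ with a countably additive $\mu:\mathcal{B}\to[0,1]$ such that $\mu(1)=1$, $\mu(a)>0$ for every $a\neq 0$, and $\mathcal{B}$ has no atoms. For $x,y\in[0,1]$, $x\star y:=\{\mu(a\wedge b): a,b\in\mathcal{B},\ \mu(a)=x,\ \mu(b)=y\}\subseteq[0,1]$. For nonempty $A\subseteq[0,1]$ and $z\in[0,1]$, $A\star z:=\bigcup_{a\in A}(a\star z)$ and $z\star A:=\bigcup_{a\in A}(z\star a)$. Here $t^+=\max\{t,0\}$. *)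

theory Defs
  imports Complex_Main "HOL-Library.Countable_Complete_Lattices"
begin

definition atom :: "'a::boolean_algebra \<Rightarrow> bool" where
  "atom a \<longleftrightarrow> a \<noteq> bot \<and> (\<forall>b. b \<le> a \<longrightarrow> b = bot \<or> b = a)"

text \<open>
  A Dedekind sigma-complete Boolean algebra is a type of sort
  \<open>{boolean_algebra, countable_complete_lattice}\<close>: since a Boolean algebra has a least and a
  greatest element, boundedness of a countable set is automatic. The constants \<open>Sup\<close> and \<open>Inf\<close>
  are specified by this sort on countable sets only; below, \<open>Sup\<close> is applied only to the range of
  a sequence.
\<close>

locale atomless_normalized_measure_algebra =
  fixes \<mu> :: "'a::{boolean_algebra, countable_complete_lattice} \<Rightarrow> real"
  assumes range_unit: "\<mu> a \<in> {0..1}"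
    and countably_additive:
      "(\<And>i j. i \<noteq> j \<Longrightarrow> inf (s i) (s j) = bot) \<Longrightarrow> (\<lambda>n::nat. \<mu> (s n)) sums \<mu> (SUP n. s n)"
    and normalized: "\<mu> top = 1"
    and strictly_positive: "a \<noteq> bot \<Longrightarrow> \<mu> a > 0"
    and atomless: "\<not> atom a"

definition star :: "('a::boolean_algebra \<Rightarrow> real) \<Rightarrow> real \<Rightarrow> real \<Rightarrow> real set" where
  "star \<mu> x y = {\<mu> (inf a b) | a b. \<mu> a = x \<and> \<mu> b = y}"

definition set_star :: "('a::boolean_algebra \<Rightarrow> real) \<Rightarrow> real set \<Rightarrow> real \<Rightarrow> real set" where
  "set_star \<mu> A z = (\<Union>a\<in>A. star \<mu> a z)"

definition star_set :: "('a::boolean_algebra \<Rightarrow> real) \<Rightarrow> real \<Rightarrow> real set \<Rightarrow> real set" where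
  "star_set \<mu> z A = (\<Union>a\<in>A. star \<mu> z a)"

end

theory Submission
  imports Defs
begin

text \<open>
  Everything rests on Sierpinski's intermediate value property: below every \<open>a\<close> there are elements
  of each measure in \<open>[0, \<mu> a]\<close>. Cutting pieces out of a set of measure \<open>x\<close> and out of its
  complement then gives \<open>x \<star> y = [(x + y - 1)\<^sup>+, min x y]\<close>, and the theorem reduces to a
  computation with intervals.
\<close>

context atomless_normalized_measure_algebra
begin

section \<open>Finite additivity, differences and complements\<close>

lemma measure_nonneg: "\<mu> a \<ge> 0"
  using range_unit[of a] by simp

lemma measure_bot: "\<mu> bot = 0"
proof -
  have "(\<lambda>n::nat. \<mu> bot) sums \<mu> (SUP n::nat. bot)"
    by (rule countably_additive) simp
  then have "(\<lambda>n::nat. \<mu> bot) \<longlonglongrightarrow> 0"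
    using summable_LIMSEQ_zero sums_summable by blast
  then show ?thesis
    by (simp add: LIMSEQ_const_iff)
qed

lemma measure_sup_disjoint:
  assumes "inf a b = bot"
  shows "\<mu> (sup a b) = \<mu> a + \<mu> b"
proof -
  \<comment> \<open>The pair is padded with \<open>bot\<close>, whose measure is already known to
    vanish, so that countable additivity yields the finite one.\<close>
  define s where "s n = (if n = 0 then a else if n = 1 then b else bot)" for n :: nat
  have "(\<lambda>n. \<mu> (s n)) sums \<mu> (SUP n. s n)"
    by (rule countably_additive) (use assms in \<open>auto simp: s_def inf_commute\<close>)
  moreover have "(SUP n. s n) = sup a b"
  proof (rule antisym)
    show "(SUP n. s n) \<le> sup a b"
      by (rule ccSUP_least) (auto simp: s_def)
    have "s 0 \<le> (SUP n. s n)" "s 1 \<le> (SUP n. s n)"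
      by (rule ccSUP_upper; simp)+
    then show "sup a b \<le> (SUP n. s n)"
      by (simp add: s_def)
  qed
  moreover have "(\<lambda>n. \<mu> (s n)) sums (\<Sum>n\<in>{0, 1}. \<mu> (s n))"
    by (rule sums_finite) (auto simp: s_def measure_bot)
  ultimately have "\<mu> (sup a b) = (\<Sum>n\<in>{0::nat, 1}. \<mu> (s n))"
    using sums_unique2 by metis
  then show ?thesis
    by (simp add: s_def)
qed

lemma measure_diff:
  assumes "b \<le> a"
  shows "\<mu> (a - b) = \<mu> a - \<mu> b"
proof -
  have "inf b (a - b) = bot"
    by (metis diff_eq inf.left_commute inf_compl_bot inf_bot_right)
  moreover have "sup b (a - b) = a"
    using assms by (simp add: diff_eq sup_inf_distrib1 sup_absorb2)
  ultimately show ?thesis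
    using measure_sup_disjoint[of b "a - b"] by simp
qed

lemma measure_mono: "b \<le> a \<Longrightarrow> \<mu> b \<le> \<mu> a"
  using measure_diff[of b a] measure_nonneg[of "a - b"] by simp

lemma measure_compl: "\<mu> (- a) = 1 - \<mu> a"
  using measure_diff[of a top] by (simp add: normalized diff_eq)

section \<open>Atomlessness and intermediate values\<close>

text \<open>Having no atoms, \<open>a\<close> splits into two nonzero pieces whose measures add up
  to \<open>\<mu> a\<close>; the lighter one serves.\<close>

lemma exists_half:
  assumes "a \<noteq> bot"
  shows "\<exists>b\<le>a. b \<noteq> bot \<and> \<mu> b \<le> \<mu> a / 2"
proof -
  obtain b where b: "b \<le> a" "b \<noteq> bot" "b \<noteq> a"
    using atomless[of a] assms unfolding atom_def by blast
  have "a - b \<noteq> bot"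
    using b by (metis diff_eq inf_shunt double_compl antisym)
  moreover have "a - b \<le> a"
    by (simp add: diff_eq)
  moreover have "\<mu> b \<le> \<mu> a / 2 \<or> \<mu> (a - b) \<le> \<mu> a / 2"
    using measure_diff[OF b(1)] by linarith
  ultimately show ?thesis
    using b by blast
qed

text \<open>Repeated halving: since \<open>\<mu> a\<close> is at most 1, the piece left after
  \<open>n\<close> rounds has measure at most \<open>(1/2) ^ n\<close>.\<close>

lemma exists_small:
  assumes "a \<noteq> bot" "e > 0"
  shows "\<exists>b\<le>a. b \<noteq> bot \<and> \<mu> b < e"
proof -
  have halving: "\<exists>b\<le>a. b \<noteq> bot \<and> \<mu> b \<le> \<mu> a / 2 ^ n" for n :: nat
  proof (induction n)
    case 0
    then show ?case using assms by auto
  next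
    case (Suc n)
    then obtain b where b: "b \<le> a" "b \<noteq> bot" "\<mu> b \<le> \<mu> a / 2 ^ n" by blast
    obtain c where c: "c \<le> b" "c \<noteq> bot" "\<mu> c \<le> \<mu> b / 2"
      using exists_half[OF b(2)] by blast
    then have "\<mu> c \<le> \<mu> a / 2 ^ Suc n"
      using b(3) by simp
    then show ?case
      using b(1) c by (meson order_trans)
  qed
  obtain n where "(1/2) ^ n < e"
    using real_arch_pow_inv[OF assms(2), of "1/2"] by auto
  moreover have "\<mu> a / 2 ^ n \<le> (1/2) ^ n"
    using range_unit[of a] by (simp add: power_one_over divide_right_mono)
  ultimately show ?thesis
    using halving[of n] by fastforce
qed

text \<open>The supremum \<open>B\<close> of an increasing chain below \<open>a\<close> has measure
  at most \<open>t\<close>, and the choice of the chain makes this measure maximal among admissible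
  elements above \<open>B\<close>. A gap between \<open>\<mu> B\<close> and \<open>t\<close> could
  then be narrowed by \<open>exists_small\<close>.\<close>

lemma intermediate_value:
  assumes "0 \<le> t" "t \<le> \<mu> a"
  shows "\<exists>b\<le>a. \<mu> b = t"
proof -
  \<comment> \<open>Greedy exhaustion: each step realises at least half of the largest admissible increase.\<close>
  have step: "\<exists>b'. (b' \<le> a \<and> \<mu> b' \<le> t) \<and> b \<le> b' \<and>
      (\<forall>c. b \<le> c \<and> c \<le> a \<and> \<mu> c \<le> t \<longrightarrow> \<mu> c - \<mu> b \<le> 2 * (\<mu> b' - \<mu> b))"
    if b: "b \<le> a \<and> \<mu> b \<le> t" for b
  proof -
    define C where "C = {c. b \<le> c \<and> c \<le> a \<and> \<mu> c \<le> t}"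
    have bC: "b \<in> C" using b by (simp add: C_def)
    have bdd: "bdd_above (\<mu> ` C)"
      by (rule bdd_aboveI[of _ t]) (auto simp: C_def)
    define r where "r = (SUP c\<in>C. \<mu> c)"
    have le_r: "\<mu> c \<le> r" if "c \<in> C" for c
      unfolding r_def using bdd that by (rule cSUP_upper2) simp
    \<comment> \<open>The supremum \<open>r\<close> need not be attained, hence the factor 2: unless
      \<open>r\<close> equals \<open>\<mu> b\<close>, the midpoint of the two lies strictly below
      \<open>r\<close>, so some member of \<open>C\<close> exceeds it.\<close>
    have "\<exists>b'\<in>C. r - \<mu> b \<le> 2 * (\<mu> b' - \<mu> b)"
    proof (cases "r = \<mu> b")
      case True
      then show ?thesis using bC by auto
    next
      case False
      then have "(r + \<mu> b) / 2 < (SUP c\<in>C. \<mu> c)"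
        using le_r[OF bC] by (simp add: r_def[symmetric])
      then obtain b' where "b' \<in> C" "(r + \<mu> b) / 2 < \<mu> b'"
        using less_cSUP_iff[OF _ bdd] bC by blast
      then show ?thesis by (auto intro!: bexI[of _ b'])
    qed
    then obtain b' where "b' \<in> C" "r - \<mu> b \<le> 2 * (\<mu> b' - \<mu> b)" by blast
    then show ?thesis
      using le_r by (intro exI[of _ b']) (force simp: C_def)
  qed
  obtain f where f: "\<And>n. f n \<le> a \<and> \<mu> (f n) \<le> t" "f 0 = bot" "\<And>n. f n \<le> f (Suc n)"
    and greedy: "\<And>n c. f n \<le> c \<Longrightarrow> c \<le> a \<Longrightarrow> \<mu> c \<le> t \<Longrightarrow>
      \<mu> c - \<mu> (f n) \<le> 2 * (\<mu> (f (Suc n)) - \<mu> (f n))"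
  proof -
    have "\<exists>f. f 0 = bot \<and> (\<forall>n. (f n \<le> a \<and> \<mu> (f n) \<le> t) \<and> f n \<le> f (Suc n) \<and>
        (\<forall>c. f n \<le> c \<and> c \<le> a \<and> \<mu> c \<le> t \<longrightarrow>
          \<mu> c - \<mu> (f n) \<le> 2 * (\<mu> (f (Suc n)) - \<mu> (f n))))"
    proof -
      \<comment> \<open>\<open>g\<close> is controlled only on elements below \<open>a\<close> of
        measure at most \<open>t\<close>, so its iterates must be shown to stay among these
        first.\<close>
      obtain g where g: "\<And>b. b \<le> a \<and> \<mu> b \<le> t \<Longrightarrow> (g b \<le> a \<and> \<mu> (g b) \<le> t) \<and> b \<le> g b \<and>
          (\<forall>c. b \<le> c \<and> c \<le> a \<and> \<mu> c \<le> t \<longrightarrow> \<mu> c - \<mu> b \<le> 2 * (\<mu> (g b) - \<mu> b))"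
        using step by metis
      define f where "f n = (g ^^ n) bot" for n
      have "f n \<le> a \<and> \<mu> (f n) \<le> t" for n
        by (induction n) (use g assms in \<open>auto simp: f_def measure_bot\<close>)
      moreover have "f (Suc n) = g (f n)" for n
        by (simp add: f_def)
      ultimately show ?thesis
        using g by (intro exI[of _ f]) (auto simp: f_def)
    qed
    then show ?thesis using that by blast
  qed
  have f_mono: "f m \<le> f n" if "m \<le> n" for m n
    using f(3) that by (rule lift_Suc_mono_le)
  \<comment> \<open>Additivity speaks of disjoint sequences, so the chain is replaced by its
    increments; their measures telescope, which gives continuity from below.\<close>
  define d where "d n = f (Suc n) - f n" for n
  define B where "B = (SUP n. d n)"
  have disjoint_less: "inf (d i) (d j) = bot" if "i < j" for i j
  proof -
    have "d i \<le> f j" "d j \<le> - f j"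
      using f_mono[of "Suc i" j] that by (auto simp: d_def diff_eq intro: le_infI1)
    then have "inf (d i) (d j) \<le> inf (f j) (- f j)"
      by (rule inf_mono)
    then show ?thesis by (simp add: bot_unique)
  qed
  have "(\<lambda>n. \<mu> (d n)) sums \<mu> B"
    unfolding B_def
  proof (rule countably_additive)
    show "inf (d i) (d j) = bot" if "i \<noteq> j" for i j
      using that disjoint_less by (metis inf_commute nat_neq_iff)
  qed
  moreover have "(\<Sum>i<n. \<mu> (d i)) = \<mu> (f n)" for n
    using sum_lessThan_telescope[of "\<lambda>i. \<mu> (f i)" n] f(2,3)
    by (simp add: d_def measure_diff measure_bot)
  ultimately have lim: "(\<lambda>n. \<mu> (f n)) \<longlonglongrightarrow> \<mu> B"
    by (simp add: sums_def)
  have f_le_B: "f n \<le> B" for n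
  proof (induction n)
    case 0
    then show ?case by (simp add: f(2))
  next
    case (Suc n)
    have "f (Suc n) = sup (f n) (d n)"
      using f(3)[of n] by (simp add: d_def diff_eq sup_inf_distrib1 sup_absorb2)
    moreover have "d n \<le> B"
      unfolding B_def by (rule ccSUP_upper) auto
    ultimately show ?case using Suc by simp
  qed
  have B_le_a: "B \<le> a"
    unfolding B_def
  proof (rule ccSUP_least)
    show "d n \<le> a" for n
      using f(1)[of "Suc n"] by (auto simp: d_def diff_eq intro: le_infI1)
  qed simp
  have B_le_t: "\<mu> B \<le> t"
    using lim f(1) by (intro LIMSEQ_le_const2[OF lim]) auto
  \<comment> \<open>Such a \<open>c\<close> lies above every \<open>f n\<close>, so
    \<open>greedy\<close> applies at each stage; in the limit the increments of the chain
    vanish.\<close>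
  have maximal: "\<mu> c \<le> \<mu> B" if "B \<le> c" "c \<le> a" "\<mu> c \<le> t" for c
  proof -
    have "\<mu> c - \<mu> (f n) \<le> 2 * (\<mu> (f (Suc n)) - \<mu> (f n))" for n
      using greedy that f_le_B order_trans by blast
    moreover have "(\<lambda>n. \<mu> c - \<mu> (f n)) \<longlonglongrightarrow> \<mu> c - \<mu> B"
      by (intro tendsto_intros lim)
    moreover have "(\<lambda>n. 2 * (\<mu> (f (Suc n)) - \<mu> (f n))) \<longlonglongrightarrow> 2 * (\<mu> B - \<mu> B)"
      by (intro tendsto_intros lim LIMSEQ_Suc)
    ultimately have "\<mu> c - \<mu> B \<le> 2 * (\<mu> B - \<mu> B)"
      using LIMSEQ_le by blast
    then show ?thesis by simp
  qed
  have "\<mu> B = t"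
  proof (rule ccontr)
    assume "\<mu> B \<noteq> t"
    then have less: "\<mu> B < t" using B_le_t by simp
    then have "\<mu> (a - B) > 0"
      using measure_diff[OF B_le_a] assms by simp
    then have "a - B \<noteq> bot" using measure_bot by (metis less_irrefl)
    \<comment> \<open>Adjoined to \<open>B\<close>, this piece keeps the measure below
      \<open>t\<close> yet raises it strictly, against \<open>maximal\<close>.\<close>
    then obtain c where c: "c \<le> a - B" "c \<noteq> bot" "\<mu> c < t - \<mu> B"
      using exists_small[of "a - B" "t - \<mu> B"] less by auto
    have "inf B c = bot"
      using c(1) by (simp add: diff_eq inf_shunt compl_le_swap1)
    then have "\<mu> (sup B c) = \<mu> B + \<mu> c"
      by (rule measure_sup_disjoint)
    moreover have "\<mu> (sup B c) \<le> \<mu> B"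
      using maximal[of "sup B c"] calculation c B_le_a by (simp add: diff_eq)
    ultimately show False
      using strictly_positive[OF c(2)] by simp
  qed
  then show ?thesis using B_le_a by blast
qed

section \<open>The interval formulas for \<open>star\<close>\<close>

lemma star_eq:
  assumes "x \<in> {0..1}" "y \<in> {0..1}"
  shows "star \<mu> x y = {max (x + y - 1) 0 .. min x y}"
proof (intro set_eqI iffI)
  fix t assume "t \<in> star \<mu> x y"
  then obtain a b where ab: "t = \<mu> (inf a b)" "\<mu> a = x" "\<mu> b = y"
    unfolding star_def by blast
  \<comment> \<open>For the lower bound: the part of \<open>b\<close> outside \<open>a\<close> has
    to fit into the complement of \<open>a\<close>.\<close>
  have "\<mu> (b - inf a b) = y - t"
    using ab by (simp add: measure_diff)
  moreover have "b - inf a b \<le> - a"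
    by (simp add: diff_eq inf_sup_distrib1)
  ultimately have "y - t \<le> 1 - x"
    using measure_mono measure_compl ab by metis
  moreover have "t \<le> x" "t \<le> y"
    using ab measure_mono[of "inf a b"] by auto
  ultimately show "t \<in> {max (x + y - 1) 0 .. min x y}"
    using measure_nonneg ab by simp
next
  fix t assume t: "t \<in> {max (x + y - 1) 0 .. min x y}"
  obtain a where a: "\<mu> a = x"
    using intermediate_value[of x top] assms by (auto simp: normalized)
  \<comment> \<open>The partner of \<open>a\<close> is assembled from \<open>c\<close> inside
    \<open>a\<close>, the future meet, and \<open>d\<close> outside; there is room for
    \<open>d\<close> because \<open>x + y - 1 \<le> t\<close>.\<close>
  obtain c where c: "c \<le> a" "\<mu> c = t"
    using intermediate_value[of t a] t a by auto
  obtain d where d: "d \<le> - a" "\<mu> d = y - t"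
    using intermediate_value[of "y - t" "- a"] t a measure_compl[of a] by auto
  have ad: "inf a d = bot"
    using d(1) by (simp add: inf_shunt compl_le_swap1)
  then have "inf c d = bot"
    using c(1) by (metis inf_mono order_refl bot_unique)
  then have "\<mu> (sup c d) = y"
    using c d by (simp add: measure_sup_disjoint)
  moreover have "inf a (sup c d) = c"
    using ad c(1) by (simp add: inf_sup_distrib1 inf_absorb2)
  ultimately show "t \<in> star \<mu> x y"
    unfolding star_def using a c(2) by force
qed

lemma star_commute: "star \<mu> x y = star \<mu> y x"
  unfolding star_def by (metis inf_commute)

lemma set_star_eq:
  assumes "x \<in> {0..1}" "y \<in> {0..1}" "z \<in> {0..1}"
  shows "set_star \<mu> (star \<mu> x y) z = {max (x + y + z - 2) 0 .. min (min x y) z}"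
proof -
  have "set_star \<mu> (star \<mu> x y) z =
      (\<Union>w\<in>{max (x + y - 1) 0 .. min x y}. {max (w + z - 1) 0 .. min w z})"
    unfolding set_star_def star_eq[OF assms(1,2)]
    using assms by (intro SUP_cong refl star_eq) auto
  also have "\<dots> = {max (x + y + z - 2) 0 .. min (min x y) z}" (is "?U = ?I")
  proof (intro set_eqI iffI)
    fix t assume "t \<in> ?U"
    then show "t \<in> ?I" by auto
  next
    fix t assume "t \<in> ?I"
    then show "t \<in> ?U"
      \<comment> \<open>The witness is the least \<open>w\<close> of the inner interval with
        \<open>t \<le> w\<close>; taking it least makes \<open>w + z - 1 \<le> t\<close>
        hold.\<close>
      using assms by (intro UN_I[of "max t (max (x + y - 1) 0)"]) auto
  qed
  finally show ?thesis .
qed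

text \<open>Turns the right bracketing into an instance of \<open>set_star_eq\<close>, whose
  interval is symmetric in the three numbers.\<close>

lemma star_set_eq_set_star: "star_set \<mu> x A = set_star \<mu> A x"
  unfolding star_set_def set_star_def by (simp add: star_commute)

end

theorem theorem1:
  fixes \<mu> :: "'a::{boolean_algebra, countable_complete_lattice} \<Rightarrow> real"
    and x y z :: real
  assumes "atomless_normalized_measure_algebra \<mu>"
    and "x \<in> {0..1}" and "y \<in> {0..1}" and "z \<in> {0..1}"
  shows "set_star \<mu> (star \<mu> x y) z = star_set \<mu> x (star \<mu> y z) \<and>
         star_set \<mu> x (star \<mu> y z) = {max (x + y + z - 2) 0 .. Min {x, y, z}}"
proof -
  interpret atomless_normalized_measure_algebra \<mu> by fact
  show ?thesis
    using assms(2-4) by (simp add: star_set_eq_set_star set_star_eq min.commute min.left_commute add_ac)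
qed

end
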